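(* Let $T$ be a locally finite tree all of whose vertices have degree $\geq 2$ and let $C>0$. Then the set of locally torsion-free groups is open in $\mathbf{Sub}(\mathrm{Aut}(T))_{\leq C}^{0}$.
   Context: $\mathrm{Aut}(T)$ carries the topology of pointwise convergence on vertices. $\mathbf{Sub}(\mathrm{Aut}(T))$ is the space of closed subgroups of $\mathrm{Aut}(T)$ with the Chabauty topology: a base of neighborhoods of $H$ is given by the sets $\{J \mid J\cap K\subseteq HU,\ H\cap K\subseteq JU\}$ with $K$ compact and $U$ an open identity neighborhood. $\mathbf{Sub}(\mathrm{Aut}(T))_{\leq C}^{0}$ is the subspace of those closed subgroups that are unimodular and have at most $C$ orbits on the vertex set of $T$. A totally disconnected locally compact group is locally torsion-free if it has an open torsion-free subgroup. *)

theory Defs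
  imports "HOL-Analysis.Analysis" "HOL-Algebra.Bij" "HOL-Algebra.Group_Action"
begin

section \<open>Trees and their automorphism groups\<close>

text \<open>
  A tree is a connected simple graph without cycles. Both orientations of each edge belong to the
  edge relation \<open>E\<close>. The \<open>tree\<close> predicate of the AFP entry Graph_Theory is not suitable here, as it
  only excludes directed cycles.
\<close>

definition is_cycle :: "'v rel \<Rightarrow> 'v list \<Rightarrow> bool" where
  "is_cycle E xs \<longleftrightarrow>
     3 \<le> length xs \<and> distinct xs \<and> successively (\<lambda>x y. (x, y) \<in> E) xs \<and> (last xs, hd xs) \<in> E"

definition is_tree :: "'v set \<Rightarrow> 'v rel \<Rightarrow> bool" where
  "is_tree V E \<longleftrightarrow>
     E \<subseteq> V \<times> V \<and> sym E \<and> irrefl E \<and>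
     V \<noteq> {} \<and> (\<forall>u\<in>V. \<forall>v\<in>V. (u, v) \<in> E\<^sup>*) \<and> (\<nexists>xs. is_cycle E xs)"

definition locally_finite_graph :: "'v set \<Rightarrow> 'v rel \<Rightarrow> bool" where
  "locally_finite_graph V E \<longleftrightarrow> (\<forall>v\<in>V. finite (E `` {v}))"

definition vertex_degree :: "'v rel \<Rightarrow> 'v \<Rightarrow> nat" where
  "vertex_degree E v = card (E `` {v})"

definition Aut :: "'v set \<Rightarrow> 'v rel \<Rightarrow> ('v \<Rightarrow> 'v) monoid" where
  "Aut V E = (BijGroup V)
     \<lparr>carrier := {f \<in> Bij V. \<forall>x\<in>V. \<forall>y\<in>V. (f x, f y) \<in> E \<longleftrightarrow> (x, y) \<in> E}\<rparr>"

definition Aut_topology :: "'v set \<Rightarrow> 'v rel \<Rightarrow> ('v \<Rightarrow> 'v) topology" where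
  "Aut_topology V E =
     subtopology (product_topology (\<lambda>_. discrete_topology V) V) (carrier (Aut V E))"


section \<open>The Chabauty topology\<close>

text \<open>A topological group is given as a group \<open>G\<close> with a topology \<open>X\<close> on its carrier.\<close>

definition closed_subgroups :: "('a, 'b) monoid_scheme \<Rightarrow> 'a topology \<Rightarrow> 'a set set" where
  "closed_subgroups G X = {H. subgroup H G \<and> closedin X H}"

definition chabauty_nhd ::
  "('a, 'b) monoid_scheme \<Rightarrow> 'a topology \<Rightarrow> 'a set \<Rightarrow> 'a set \<Rightarrow> 'a set \<Rightarrow> 'a set set" where
  "chabauty_nhd G X H K U =
     {J \<in> closed_subgroups G X. J \<inter> K \<subseteq> H <#>\<^bsub>G\<^esub> U \<and> H \<inter> K \<subseteq> J <#>\<^bsub>G\<^esub> U}"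

definition chabauty_open :: "('a, 'b) monoid_scheme \<Rightarrow> 'a topology \<Rightarrow> 'a set set \<Rightarrow> bool" where
  "chabauty_open G X S \<longleftrightarrow>
     S \<subseteq> closed_subgroups G X \<and>
     (\<forall>H\<in>S. \<exists>K U. compactin X K \<and> openin X U \<and> \<one>\<^bsub>G\<^esub> \<in> U \<and> chabauty_nhd G X H K U \<subseteq> S)"

definition chabauty :: "('a, 'b) monoid_scheme \<Rightarrow> 'a topology \<Rightarrow> 'a set topology" where
  "chabauty G X = topology (chabauty_open G X)"

lemma chabauty_nhd_antimono:
  assumes "K \<subseteq> K'" "U' \<subseteq> U"
  shows "chabauty_nhd G X H K' U' \<subseteq> chabauty_nhd G X H K U"
proof
  fix J assume J: "J \<in> chabauty_nhd G X H K' U'"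
  have "A <#>\<^bsub>G\<^esub> U' \<subseteq> A <#>\<^bsub>G\<^esub> U" for A
    using assms(2) by (intro mono_set_mult) auto
  moreover have "J \<inter> K \<subseteq> J \<inter> K'" "H \<inter> K \<subseteq> H \<inter> K'"
    using assms(1) by auto
  ultimately show "J \<in> chabauty_nhd G X H K U"
    using J unfolding chabauty_nhd_def mem_Collect_eq by (meson order_trans)
qed

lemma chabauty_openD:
  assumes "chabauty_open G X S" "H \<in> S"
  obtains K U where "compactin X K" "openin X U" "\<one>\<^bsub>G\<^esub> \<in> U" "chabauty_nhd G X H K U \<subseteq> S"
proof -
  have "\<exists>K U. compactin X K \<and> openin X U \<and> \<one>\<^bsub>G\<^esub> \<in> U \<and> chabauty_nhd G X H K U \<subseteq> S"
    using assms unfolding chabauty_open_def by (elim conjE) (erule bspec)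
  then show thesis using that by (elim exE conjE)
qed

lemma istopology_chabauty_open: "istopology (chabauty_open G X)"
  unfolding istopology_def
proof (intro conjI allI impI)
  fix S T assume S: "chabauty_open G X S" and T: "chabauty_open G X T"
  have "S \<inter> T \<subseteq> closed_subgroups G X"
    using S unfolding chabauty_open_def by (elim conjE) (rule le_infI1)
  moreover have "\<exists>K U. compactin X K \<and> openin X U \<and> \<one>\<^bsub>G\<^esub> \<in> U \<and> chabauty_nhd G X H K U \<subseteq> S \<inter> T"
    if H: "H \<in> S \<inter> T" for H
  proof -
    obtain K U where 1: "compactin X K" "openin X U" "\<one>\<^bsub>G\<^esub> \<in> U" "chabauty_nhd G X H K U \<subseteq> S"
      using chabauty_openD[OF S IntD1[OF H]] .
    obtain K' U' where 2: "compactin X K'" "openin X U'" "\<one>\<^bsub>G\<^esub> \<in> U'" "chabauty_nhd G X H K' U' \<subseteq> T"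
      using chabauty_openD[OF T IntD2[OF H]] .
    have "chabauty_nhd G X H (K \<union> K') (U \<inter> U') \<subseteq> S \<inter> T"
      by (intro Int_greatest order_trans[OF chabauty_nhd_antimono 1(4)]
          order_trans[OF chabauty_nhd_antimono 2(4)]) simp_all
    moreover have "compactin X (K \<union> K')" "openin X (U \<inter> U')" "\<one>\<^bsub>G\<^esub> \<in> U \<inter> U'"
      using 1 2 by (simp_all add: compactin_Un openin_Int)
    ultimately show ?thesis by (intro exI conjI)
  qed
  ultimately show "chabauty_open G X (S \<inter> T)"
    unfolding chabauty_open_def by (intro conjI ballI)
next
  fix \<K> assume *: "\<forall>S\<in>\<K>. chabauty_open G X S"
  have "\<Union>\<K> \<subseteq> closed_subgroups G X"
    using * unfolding chabauty_open_def by (simp add: Sup_le_iff)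
  moreover have "\<exists>K U. compactin X K \<and> openin X U \<and> \<one>\<^bsub>G\<^esub> \<in> U \<and> chabauty_nhd G X H K U \<subseteq> \<Union>\<K>"
    if "H \<in> \<Union>\<K>" for H
  proof -
    obtain S where S: "S \<in> \<K>" "H \<in> S" using \<open>H \<in> \<Union>\<K>\<close> by (rule UnionE)
    obtain K U where 1: "compactin X K" "openin X U" "\<one>\<^bsub>G\<^esub> \<in> U" "chabauty_nhd G X H K U \<subseteq> S"
      using chabauty_openD[OF bspec[OF * S(1)] S(2)] .
    show ?thesis
      using 1(1-3) order_trans[OF 1(4) Union_upper[OF S(1)]] by (intro exI conjI)
  qed
  ultimately show "chabauty_open G X (\<Union>\<K>)"
    unfolding chabauty_open_def by (intro conjI ballI)
qed

lemma openin_chabauty: "openin (chabauty G X) = chabauty_open G X"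
  unfolding chabauty_def by (rule topology_inverse'[OF istopology_chabauty_open])


section \<open>Unimodular groups\<close>

text \<open>A left Haar measure is a nonzero left-invariant Radon measure on the Borel sets.\<close>

definition left_haar_measure ::
  "('a, 'b) monoid_scheme \<Rightarrow> 'a topology \<Rightarrow> 'a measure \<Rightarrow> bool" where
  "left_haar_measure G X M \<longleftrightarrow>
     sets M = sigma_sets (topspace X) {U. openin X U} \<and>
     emeasure M (topspace X) \<noteq> 0 \<and>
     (\<forall>K. compactin X K \<longrightarrow> emeasure M K < \<infinity>) \<and>
     (\<forall>A\<in>sets M. emeasure M A = (INF U\<in>{U. openin X U \<and> A \<subseteq> U}. emeasure M U)) \<and>
     (\<forall>U. openin X U \<longrightarrow> emeasure M U = (SUP K\<in>{K. compactin X K \<and> K \<subseteq> U}. emeasure M K)) \<and>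
     (\<forall>g\<in>carrier G. \<forall>A\<in>sets M. emeasure M (g <#\<^bsub>G\<^esub> A) = emeasure M A)"

definition unimodular :: "('a, 'b) monoid_scheme \<Rightarrow> 'a topology \<Rightarrow> bool" where
  "unimodular G X \<longleftrightarrow>
     (\<exists>M. left_haar_measure G X M \<and>
          (\<forall>g\<in>carrier G. \<forall>A\<in>sets M. emeasure M (A #>\<^bsub>G\<^esub> g) = emeasure M A))"


section \<open>Locally torsion-free groups\<close>

definition torsion_free :: "('a, 'b) monoid_scheme \<Rightarrow> bool" where
  "torsion_free G \<longleftrightarrow>
     (\<forall>g\<in>carrier G. \<forall>n::nat. 0 < n \<and> g [^]\<^bsub>G\<^esub> n = \<one>\<^bsub>G\<^esub> \<longrightarrow> g = \<one>\<^bsub>G\<^esub>)"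

definition locally_torsion_free :: "('a, 'b) monoid_scheme \<Rightarrow> 'a topology \<Rightarrow> bool" where
  "locally_torsion_free G X \<longleftrightarrow>
     (\<exists>L. subgroup L G \<and> openin X L \<and> torsion_free (G\<lparr>carrier := L\<rparr>))"


section \<open>Unimodular closed subgroups with few orbits\<close>

definition Sub_le0 :: "'v set \<Rightarrow> 'v rel \<Rightarrow> real \<Rightarrow> ('v \<Rightarrow> 'v) set set" where
  "Sub_le0 V E C =
     {H \<in> closed_subgroups (Aut V E) (Aut_topology V E).
        unimodular ((Aut V E)\<lparr>carrier := H\<rparr>) (subtopology (Aut_topology V E) H) \<and>
        finite (orbits ((Aut V E)\<lparr>carrier := H\<rparr>) V (\<lambda>g. g)) \<and>
        real (card (orbits ((Aut V E)\<lparr>carrier := H\<rparr>) V (\<lambda>g. g))) \<le> C}"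

lemma group_Aut: "group (Aut V E)"
proof -
  let ?A = "{f \<in> Bij V. \<forall>x\<in>V. \<forall>y\<in>V. (f x, f y) \<in> E \<longleftrightarrow> (x, y) \<in> E}"
  have maps: "f x \<in> V" if "f \<in> Bij V" "x \<in> V" for f x
    using that by (auto simp: Bij_def bij_betw_def)
  have "subgroup ?A (BijGroup V)"
  proof (rule group.subgroupI[OF group_BijGroup])
    show "?A \<subseteq> carrier (BijGroup V)" by (auto simp: BijGroup_def)
    have "(\<lambda>x\<in>V. x) \<in> ?A" by (auto simp: id_Bij)
    then show "?A \<noteq> {}" by blast
  next
    fix f assume f: "f \<in> ?A"
    then have fB: "f \<in> Bij V" by blast
    have bij: "bij_betw f V V" using fB by (simp add: Bij_def)
    have *: "inv_into V f x \<in> V" "f (inv_into V f x) = x" if "x \<in> V" for x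
      using bij that by (auto simp: bij_betw_def inv_into_into f_inv_into_f)
    have "(inv_into V f x, inv_into V f y) \<in> E \<longleftrightarrow> (x, y) \<in> E" if "x \<in> V" "y \<in> V" for x y
    proof -
      have "(f (inv_into V f x), f (inv_into V f y)) \<in> E \<longleftrightarrow> (inv_into V f x, inv_into V f y) \<in> E"
        using f *(1)[OF that(1)] *(1)[OF that(2)] by blast
      then show ?thesis by (simp only: *(2)[OF that(1)] *(2)[OF that(2)])
    qed
    then show "inv\<^bsub>BijGroup V\<^esub> f \<in> ?A"
      using restrict_inv_into_Bij[OF fB] by (simp add: inv_BijGroup[OF fB])
  next
    fix f g assume f: "f \<in> ?A" and g: "g \<in> ?A"
    then have "compose V f g \<in> Bij V" by (intro compose_Bij) auto
    moreover have "(compose V f g x, compose V f g y) \<in> E \<longleftrightarrow> (x, y) \<in> E"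
      if "x \<in> V" "y \<in> V" for x y
      using f g that maps[of g x] maps[of g y] by (simp add: compose_def)
    ultimately show "f \<otimes>\<^bsub>BijGroup V\<^esub> g \<in> ?A"
      using f g by (simp add: BijGroup_def)
  qed
  then show ?thesis
    unfolding Aut_def by (rule subgroup.subgroup_is_group[OF _ group_BijGroup])
qed

end

theory Submission
  imports Defs
begin

text \<open>
  Let \<open>H\<close> be a closed subgroup in which no nontrivial torsion element fixes the ball \<open>B(x, m)\<close>.
  In a subgroup with at most \<open>c\<close> orbits every vertex can be moved into \<open>B(x, c)\<close>. With \<open>n = c + m\<close>,
  suppose that a nontrivial torsion element of such a subgroup \<open>J\<close> fixes \<open>B(x, n)\<close>. Some power \<open>g\<close> of it
  has prime order, and somewhere along a path there is a vertex \<open>y\<close> such that \<open>g\<close> fixes \<open>B(y, n)\<close> but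
  not \<open>B(y, n + 1)\<close>. After conjugating in \<open>J\<close> we may take \<open>y\<close> in \<open>B(x, c)\<close>, and the order of \<open>g\<close> is at
  most the size of \<open>B(y, n + 1)\<close>, as \<open>g\<close> permutes that ball nontrivially. All such \<open>g\<close> lie in one
  compact set \<open>K\<close> that is disjoint from \<open>H\<close>, and to be disjoint from \<open>K\<close> is a Chabauty-open condition.
\<close>

section \<open>Locally finite connected graphs and their automorphisms\<close>

locale locally_finite_connected_graph =
  fixes V :: "'v set" and E :: "'v rel"
  assumes edges: "E \<subseteq> V \<times> V"
    and symE: "sym E"
    and connected: "\<And>u v. u \<in> V \<Longrightarrow> v \<in> V \<Longrightarrow> (u, v) \<in> E\<^sup>*"
    and locfin: "locally_finite_graph V E"
begin

abbreviation "G \<equiv> Aut V E"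
abbreviation "X \<equiv> Aut_topology V E"

text \<open>The reflexive closure lets a walk pause, so walks of exactly \<open>n\<close> steps
  reach every vertex at distance at most \<open>n\<close>: this is the closed ball, not the
  sphere.\<close>

definition vball :: "'v \<Rightarrow> nat \<Rightarrow> 'v set" where
  "vball x n = ((E\<^sup>=) ^^ n) `` {x}"

definition fixing :: "'v set \<Rightarrow> ('v \<Rightarrow> 'v) set" where
  "fixing F = {g \<in> carrier G. \<forall>v\<in>F. g v = v}"

sublocale Aut: group "Aut V E"
  by (rule group_Aut)

section \<open>Balls\<close>

lemma vball_0 [simp]: "vball x 0 = {x}"
  by (simp add: vball_def)

lemma vball_Suc: "vball x (Suc n) = (\<Union>u\<in>vball x n. insert u (E `` {u}))"
  by (auto simp: vball_def relcomp_unfold)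

lemma vball_subset: "x \<in> V \<Longrightarrow> vball x n \<subseteq> V"
  using edges by (induction n) (auto simp: vball_Suc)

lemma finite_vball: "x \<in> V \<Longrightarrow> finite (vball x n)"
proof (induction n)
  case (Suc n)
  then show ?case
    using locfin vball_subset[OF Suc.prems, of n]
    by (auto simp: vball_Suc locally_finite_graph_def)
qed simp

lemma vball_trans: "y \<in> vball x m \<Longrightarrow> z \<in> vball y n \<Longrightarrow> z \<in> vball x (m + n)"
  by (auto simp: vball_def relpow_add)

lemma vball_mono: "m \<le> n \<Longrightarrow> vball x m \<subseteq> vball x n"
  by (rule lift_Suc_mono_le[where f = "vball x"]) (auto simp: vball_Suc)

lemma vball_self [simp]: "x \<in> vball x n"
  using vball_mono[of 0 n x] by simp

lemma vball_sym: "y \<in> vball x n \<Longrightarrow> x \<in> vball y n"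
proof (induction n arbitrary: y)
  case (Suc n)
  then obtain u where u: "u \<in> vball x n" "y = u \<or> (u, y) \<in> E"
    by (auto simp: vball_Suc)
  then have "u \<in> vball y 1"
    using symE by (auto simp: vball_Suc sym_def)
  then show ?case using vball_trans[OF _ Suc.IH[OF u(1)], of y 1] by simp
qed (simp add: vball_def)

lemma vball_exhausts:
  assumes "x \<in> V" "v \<in> V" obtains n where "v \<in> vball x n"
proof -
  have "(x, v) \<in> (E\<^sup>=)\<^sup>*" using connected[OF assms] by simp
  then obtain n where "(x, v) \<in> (E\<^sup>=) ^^ n" using rtrancl_imp_relpow by blast
  then show thesis using that[of n] by (simp add: vball_def)
qed

lemma finite_subset_vball:
  assumes "x \<in> V" "finite F" "F \<subseteq> V" obtains n where "F \<subseteq> vball x n"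
proof -
  have "\<exists>n. F \<subseteq> vball x n"
    using assms(2,3)
  proof (induction F)
    case (insert v F)
    then obtain n where n: "F \<subseteq> vball x n" by auto
    obtain k where k: "v \<in> vball x k" using vball_exhausts[OF assms(1), of v] insert by auto
    have "insert v F \<subseteq> vball x (max n k)"
      using n k vball_mono[of n "max n k" x] vball_mono[of k "max n k" x] by auto
    then show ?case by blast
  qed simp
  then show thesis using that by blast
qed

section \<open>Automorphisms\<close>

lemma carrier_iff:
  "g \<in> carrier G \<longleftrightarrow>
     g \<in> extensional V \<and> bij_betw g V V \<and> (\<forall>x\<in>V. \<forall>y\<in>V. (g x, g y) \<in> E \<longleftrightarrow> (x, y) \<in> E)"
  by (auto simp: Aut_def Bij_def)

lemma aut_in_V: "g \<in> carrier G \<Longrightarrow> v \<in> V \<Longrightarrow> g v \<in> V"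
  by (auto simp: carrier_iff bij_betw_def)

lemma aut_inj: "g \<in> carrier G \<Longrightarrow> u \<in> V \<Longrightarrow> v \<in> V \<Longrightarrow> g u = g v \<longleftrightarrow> u = v"
  by (auto simp: carrier_iff bij_betw_def inj_on_def)

lemma aut_mult: "g \<in> carrier G \<Longrightarrow> h \<in> carrier G \<Longrightarrow> v \<in> V \<Longrightarrow> (g \<otimes>\<^bsub>G\<^esub> h) v = g (h v)"
  by (simp add: Aut_def BijGroup_def compose_def)

lemma aut_one: "v \<in> V \<Longrightarrow> \<one>\<^bsub>G\<^esub> v = v"
  by (simp add: Aut_def BijGroup_def)

lemma aut_inv:
  assumes "g \<in> carrier G" "v \<in> V"
  shows "(inv\<^bsub>G\<^esub> g) (g v) = v" "g ((inv\<^bsub>G\<^esub> g) v) = v"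
  using assms aut_mult[of "inv\<^bsub>G\<^esub> g" g v] aut_mult[of g "inv\<^bsub>G\<^esub> g" v]
  by (simp_all add: aut_one)

lemma aut_eqI:
  "g \<in> carrier G \<Longrightarrow> h \<in> carrier G \<Longrightarrow> (\<And>v. v \<in> V \<Longrightarrow> g v = h v) \<Longrightarrow> g = h"
  by (auto simp: carrier_iff intro: extensionalityI)

lemma aut_pow: "g \<in> carrier G \<Longrightarrow> v \<in> V \<Longrightarrow> (g [^]\<^bsub>G\<^esub> (n::nat)) v = (g ^^ n) v"
proof (induction n arbitrary: v)
  case (Suc n)
  then show ?case by (simp add: aut_mult aut_in_V funpow_swap1)
qed (simp add: aut_one)

lemma aut_vball:
  assumes "g \<in> carrier G" "x \<in> V" "v \<in> vball x n" shows "g v \<in> vball (g x) n"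
  using assms(3)
proof (induction n arbitrary: v)
  case (Suc n)
  then obtain u where u: "u \<in> vball x n" "v = u \<or> (u, v) \<in> E" by (auto simp: vball_Suc)
  then have "u \<in> V" using vball_subset[OF assms(2)] by blast
  then have "g v = g u \<or> (g u, g v) \<in> E"
    using u assms(1) edges by (auto simp: carrier_iff)
  then show ?case using Suc.IH[OF u(1)] by (auto simp: vball_Suc)
qed simp

lemma aut_vball_iff:
  assumes "g \<in> carrier G" "x \<in> V" "v \<in> V"
  shows "g v \<in> vball (g x) n \<longleftrightarrow> v \<in> vball x n"
proof
  assume "g v \<in> vball (g x) n"
  from aut_vball[OF _ _ this, of "inv\<^bsub>G\<^esub> g"] show "v \<in> vball x n"
    using assms by (simp add: aut_inv aut_in_V)
qed (use assms aut_vball in blast)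

lemma fixing_subgroup:
  assumes "F \<subseteq> V" shows "subgroup (fixing F) G"
proof (rule Aut.subgroupI)
  show "fixing F \<noteq> {}" using assms aut_one by (force simp: fixing_def)
  show "inv\<^bsub>G\<^esub> g \<in> fixing F" if "g \<in> fixing F" for g
    using that assms aut_inv(1)[of g] by (fastforce simp: fixing_def)
  show "g \<otimes>\<^bsub>G\<^esub> h \<in> fixing F" if "g \<in> fixing F" "h \<in> fixing F" for g h
    using that assms by (auto simp: fixing_def aut_mult subset_iff)
qed (auto simp: fixing_def)

lemma fixing_mono: "F \<subseteq> F' \<Longrightarrow> fixing F' \<subseteq> fixing F"
  by (auto simp: fixing_def)

text \<open>An automorphism \<open>j\<close> maps the ball around \<open>y\<close> onto the ball of
  the same radius around \<open>j y\<close>, and the conjugate fixes \<open>j v\<close> exactly when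
  \<open>g\<close> fixes \<open>v\<close>. This is what allows torsion found far away to be moved
  close to the base vertex.\<close>

lemma fixing_conj:
  assumes "g \<in> carrier G" "j \<in> carrier G" "y \<in> V"
  shows "j \<otimes>\<^bsub>G\<^esub> g \<otimes>\<^bsub>G\<^esub> inv\<^bsub>G\<^esub> j \<in> fixing (vball (j y) n) \<longleftrightarrow> g \<in> fixing (vball y n)"
proof -
  have conj: "(j \<otimes>\<^bsub>G\<^esub> g \<otimes>\<^bsub>G\<^esub> inv\<^bsub>G\<^esub> j) (j v) = j v \<longleftrightarrow> g v = v" if "v \<in> V" for v
    using that assms by (simp add: aut_mult aut_inv aut_in_V aut_inj)
  have "vball (j y) n = j ` vball y n"
  proof (intro subset_antisym subsetI)
    fix w assume w: "w \<in> vball (j y) n"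
    then have "w \<in> V" using vball_subset assms aut_in_V by blast
    then have "inv\<^bsub>G\<^esub> j \<in> carrier G" "j ((inv\<^bsub>G\<^esub> j) w) = w" "(inv\<^bsub>G\<^esub> j) w \<in> V"
      using assms by (auto simp: aut_inv aut_in_V)
    then show "w \<in> j ` vball y n"
      using w aut_vball_iff[OF assms(2,3), of "(inv\<^bsub>G\<^esub> j) w" n] by (metis imageI)
  qed (use assms aut_vball in auto)
  then show ?thesis
    using conj assms vball_subset[OF assms(3), of n] by (auto simp: fixing_def subset_iff)
qed

section \<open>The topology\<close>

text \<open>The factors are discrete, so a basic open box around \<open>g\<close> can be shrunk to
  prescribing the values of \<open>g\<close> on the finitely many constrained coordinates. Openness
  becomes a statement about agreement on finite sets.\<close>

lemma openin_pointwise: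
  "openin (product_topology (\<lambda>_. discrete_topology V) V) S \<longleftrightarrow>
     S \<subseteq> PiE V (\<lambda>_. V) \<and>
     (\<forall>g\<in>S. \<exists>F. finite F \<and> F \<subseteq> V \<and> (\<forall>g'\<in>PiE V (\<lambda>_. V). (\<forall>v\<in>F. g' v = g v) \<longrightarrow> g' \<in> S))"
  (is "?L \<longleftrightarrow> ?R")
proof
  assume L: ?L
  show ?R
  proof (intro conjI ballI)
    show "S \<subseteq> PiE V (\<lambda>_. V)" using openin_subset[OF L] by (simp add: topspace_product_topology)
    fix g assume "g \<in> S"
    then obtain U where U: "finite {i \<in> V. U i \<noteq> V}" "g \<in> PiE V U" "PiE V U \<subseteq> S"
      using L by (auto simp: openin_product_topology_alt)
    have "g' \<in> PiE V U" if "g' \<in> PiE V (\<lambda>_. V)" "\<forall>v\<in>{i \<in> V. U i \<noteq> V}. g' v = g v" for g'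
    proof (rule PiE_I)
      fix v assume "v \<in> V" then show "g' v \<in> U v"
        using that U(2) by (cases "U v = V") (auto simp: PiE_iff)
    qed (use that in \<open>auto simp: PiE_iff extensional_def\<close>)
    then show "\<exists>F. finite F \<and> F \<subseteq> V \<and> (\<forall>g'\<in>PiE V (\<lambda>_. V). (\<forall>v\<in>F. g' v = g v) \<longrightarrow> g' \<in> S)"
      using U(1,3) by (intro exI[of _ "{i \<in> V. U i \<noteq> V}"]) blast
  qed
next
  assume R: ?R
  show ?L
    unfolding openin_product_topology_alt
  proof (intro ballI)
    fix g assume g: "g \<in> S"
    then obtain F where F: "finite F" "F \<subseteq> V"
      "\<forall>g'\<in>PiE V (\<lambda>_. V). (\<forall>v\<in>F. g' v = g v) \<longrightarrow> g' \<in> S" using R by meson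
    let ?U = "\<lambda>v. if v \<in> F then {g v} else V"
    have gV: "g \<in> PiE V (\<lambda>_. V)" using g R by blast
    have "{i \<in> V. ?U i \<noteq> V} \<subseteq> F" by auto
    then have "finite {i \<in> V. ?U i \<noteq> V}" using F(1) finite_subset by blast
    moreover have "PiE V ?U \<subseteq> S"
    proof
      fix g' assume g': "g' \<in> PiE V ?U"
      have "g' v \<in> V" if "v \<in> V" for v
        using PiE_mem[OF g' that] PiE_mem[OF gV that] by (auto split: if_splits)
      then have "g' \<in> PiE V (\<lambda>_. V)" using g' by (auto simp: PiE_iff)
      moreover have "\<forall>v\<in>F. g' v = g v" using g' F(2) by (force simp: PiE_iff)
      ultimately show "g' \<in> S" using F(3) by blast
    qed
    moreover have "\<forall>v\<in>V. openin (discrete_topology V) (?U v)" "g \<in> PiE V ?U"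
      using gV by (auto simp: PiE_iff)
    ultimately show "\<exists>U. finite {i \<in> V. U i \<noteq> topspace (discrete_topology V)} \<and>
        (\<forall>i\<in>V. openin (discrete_topology V) (U i)) \<and> g \<in> PiE V U \<and> PiE V U \<subseteq> S"
      by (intro exI[of _ ?U]) simp
  qed
qed

lemma carrier_subset_PiE: "carrier G \<subseteq> PiE V (\<lambda>_. V)"
  by (auto simp: aut_in_V) (auto simp: carrier_iff extensional_def)

lemma topspace_X: "topspace X = carrier G"
  using carrier_subset_PiE by (auto simp: Aut_topology_def)

lemma openin_X:
  "openin X S \<longleftrightarrow>
     S \<subseteq> carrier G \<and>
     (\<forall>g\<in>S. \<exists>F. finite F \<and> F \<subseteq> V \<and> (\<forall>g'\<in>carrier G. (\<forall>v\<in>F. g' v = g v) \<longrightarrow> g' \<in> S))"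
  (is "?L \<longleftrightarrow> ?R")
proof
  assume ?L
  then obtain T where T: "openin (product_topology (\<lambda>_. discrete_topology V) V) T"
    and S: "S = T \<inter> carrier G"
    by (auto simp: Aut_topology_def openin_subtopology)
  have "\<exists>F. finite F \<and> F \<subseteq> V \<and> (\<forall>g'\<in>carrier G. (\<forall>v\<in>F. g' v = g v) \<longrightarrow> g' \<in> S)"
    if "g \<in> S" for g
  proof -
    have "g \<in> T" using that S by blast
    then obtain F where F: "finite F" "F \<subseteq> V"
      "\<forall>g'\<in>PiE V (\<lambda>_. V). (\<forall>v\<in>F. g' v = g v) \<longrightarrow> g' \<in> T"
      using T unfolding openin_pointwise by meson
    show ?thesis using F carrier_subset_PiE S by (intro exI[of _ F]) auto
  qed
  then show ?R using S by blast
next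
  assume R: ?R
  \<comment> \<open>The largest open set of functions whose trace on the automorphism group lies in
    \<open>S\<close>. Its members need not be automorphisms.\<close>
  let ?T = "{f \<in> PiE V (\<lambda>_. V). \<exists>F. finite F \<and> F \<subseteq> V \<and>
      (\<forall>g'\<in>carrier G. (\<forall>v\<in>F. g' v = f v) \<longrightarrow> g' \<in> S)}"
  have "openin (product_topology (\<lambda>_. discrete_topology V) V) ?T"
    unfolding openin_pointwise
  proof (intro conjI ballI)
    fix f assume "f \<in> ?T"
    then obtain F where F: "finite F" "F \<subseteq> V"
      "\<forall>g'\<in>carrier G. (\<forall>v\<in>F. g' v = f v) \<longrightarrow> g' \<in> S" by blast
    have "f' \<in> ?T" if "f' \<in> PiE V (\<lambda>_. V)" "\<forall>v\<in>F. f' v = f v" for f'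
      using F that by auto
    then show "\<exists>F. finite F \<and> F \<subseteq> V \<and>
        (\<forall>g'\<in>PiE V (\<lambda>_. V). (\<forall>v\<in>F. g' v = f v) \<longrightarrow> g' \<in> ?T)"
      using F(1,2) by (intro exI[of _ F] conjI ballI impI)
  qed blast
  moreover have "S = ?T \<inter> carrier G"
  proof
    show "S \<subseteq> ?T \<inter> carrier G"
    proof
      fix g assume "g \<in> S"
      then have "g \<in> carrier G"
        "\<exists>F. finite F \<and> F \<subseteq> V \<and> (\<forall>g'\<in>carrier G. (\<forall>v\<in>F. g' v = g v) \<longrightarrow> g' \<in> S)"
        using R by auto
      then show "g \<in> ?T \<inter> carrier G" using carrier_subset_PiE by auto
    qed
    show "?T \<inter> carrier G \<subseteq> S" by auto
  qed
  ultimately show ?L by (auto simp: Aut_topology_def openin_subtopology)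
qed

lemma openin_fixing: "finite F \<Longrightarrow> F \<subseteq> V \<Longrightarrow> openin X (fixing F)"
  unfolding openin_X fixing_def by auto

lemma openin_X_one:
  assumes "openin X S" "\<one>\<^bsub>G\<^esub> \<in> S"
  obtains F where "finite F" "F \<subseteq> V" "fixing F \<subseteq> S"
proof -
  obtain F where F: "finite F" "F \<subseteq> V"
      "\<forall>g'\<in>carrier G. (\<forall>v\<in>F. g' v = \<one>\<^bsub>G\<^esub> v) \<longrightarrow> g' \<in> S"
    using assms unfolding openin_X by meson
  have "fixing F \<subseteq> S" using F(2,3) by (auto simp: fixing_def aut_one subset_iff)
  then show thesis using that F by blast
qed

text \<open>An automorphism fixing \<open>y\<close> preserves every ball around \<open>y\<close>, so
  the stabilizer lies in a product of finite sets, which is compact by Tychonoff. It remains to see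
  that it is closed among all functions; the delicate point is that surjectivity survives
  limits.\<close>

lemma compactin_stabilizer:
  assumes y: "y \<in> V" shows "compactin X (fixing {y})"
proof -
  let ?P = "product_topology (\<lambda>_. discrete_topology V) V"
  obtain d where d: "\<And>v. v \<in> V \<Longrightarrow> v \<in> vball y (d v)"
    using vball_exhausts[OF y] by meson
  have stab_ball: "g v \<in> vball y n \<longleftrightarrow> v \<in> vball y n" if "g \<in> fixing {y}" "v \<in> V" for g v n
    using that y aut_vball_iff[of g y v n] by (simp add: fixing_def)
  have "compactin ?P (PiE V (\<lambda>v. vball y (d v)))"
    using finite_vball[OF y] vball_subset[OF y] by (simp add: compactin_PiE compactin_discrete_topology)
  moreover have "fixing {y} \<subseteq> PiE V (\<lambda>v. vball y (d v))"
  proof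
    fix g assume g: "g \<in> fixing {y}"
    then have "g \<in> PiE V (\<lambda>_. V)" using carrier_subset_PiE by (auto simp: fixing_def)
    then show "g \<in> PiE V (\<lambda>v. vball y (d v))" using stab_ball[OF g] d by (auto simp: PiE_iff)
  qed
  moreover have "closedin ?P (fixing {y})"
    unfolding closedin_def openin_pointwise
  proof (intro conjI ballI)
    show "fixing {y} \<subseteq> topspace ?P" using carrier_subset_PiE by (auto simp: fixing_def)
    fix f assume "f \<in> topspace ?P - fixing {y}"
    then have fV: "f \<in> PiE V (\<lambda>_. V)" and nf: "f \<notin> fixing {y}" by auto
    have "\<exists>F. finite F \<and> F \<subseteq> V \<and> (\<forall>g. (\<forall>v\<in>F. g v = f v) \<longrightarrow> g \<notin> fixing {y})"
    proof -
      \<comment> \<open>The ways in which \<open>f\<close> can fail to be an automorphism fixing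
        \<open>y\<close>. All but the last are visible on at most two vertices.\<close>
      consider "f y \<noteq> y" | u v where "u \<in> V" "v \<in> V" "u \<noteq> v" "f u = f v"
        | u v where "u \<in> V" "v \<in> V" "\<not> ((f u, f v) \<in> E \<longleftrightarrow> (u, v) \<in> E)"
        | v where "v \<in> V" "v \<notin> f ` V"
        using nf fV by (auto simp: fixing_def carrier_iff bij_betw_def inj_on_def PiE_iff; blast)
      then show ?thesis
      proof cases
        case 1
        then show ?thesis using y by (intro exI[of _ "{y}"]) (auto simp: fixing_def)
      next
        case (2 u v)
        then have "g \<notin> fixing {y}" if "g u = f u" "g v = f v" for g
          using that aut_inj[of g u v] by (auto simp: fixing_def)
        then show ?thesis using 2 by (intro exI[of _ "{u, v}"]) auto
      next
        case (3 u v)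
        then have "g \<notin> fixing {y}" if "g u = f u" "g v = f v" for g
          using that unfolding fixing_def carrier_iff mem_Collect_eq by metis
        then show ?thesis using 3 by (intro exI[of _ "{u, v}"]) auto
      next
        case (4 v)
        \<comment> \<open>Non-surjectivity is also a finite condition here: an automorphism fixing
          \<open>y\<close> can attain \<open>v\<close> only at a vertex of the finite ball of radius
          \<open>d v\<close>, so agreeing with \<open>f\<close> there makes it miss
          \<open>v\<close>.\<close>
        have "g \<notin> fixing {y}" if g: "\<forall>w\<in>vball y (d v). g w = f w" for g
        proof
          assume gy: "g \<in> fixing {y}"
          then have "g ` V = V" by (auto simp: fixing_def carrier_iff bij_betw_def)
          then obtain w where w: "w \<in> V" "g w = v" using 4(1) by (metis imageE)
          then have "w \<in> vball y (d v)" using stab_ball[OF gy w(1)] d[OF 4(1)] by simp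
          then have "f w = v" using g w(2) by metis
          then show False using w(1) 4(2) by blast
        qed
        then show ?thesis
          using finite_vball[OF y] vball_subset[OF y] by (intro exI[of _ "vball y (d v)"]) simp
      qed
    qed
    then obtain F where "finite F" "F \<subseteq> V" "\<And>g. (\<forall>v\<in>F. g v = f v) \<Longrightarrow> g \<notin> fixing {y}"
      by auto
    then show "\<exists>F. finite F \<and> F \<subseteq> V \<and> (\<forall>g\<in>PiE V (\<lambda>_. V).
        (\<forall>v\<in>F. g v = f v) \<longrightarrow> g \<in> topspace ?P - fixing {y})"
      by (intro exI[of _ F]) simp
  qed auto
  ultimately have "compactin ?P (fixing {y})" by (rule closed_compactin)
  then show ?thesis by (auto simp: Aut_topology_def compactin_subtopology fixing_def)
qed

text \<open>If the \<open>n\<close>-th power of \<open>g\<close> moves \<open>v\<close>, then every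
  automorphism agreeing with \<open>g\<close> on the first \<open>n\<close> points \<open>v\<close>,
  \<open>g v\<close>, ... of the orbit of \<open>v\<close> has the same \<open>n\<close>-th iterate
  at \<open>v\<close>. So the complement is open.\<close>

lemma closedin_exponent: "closedin X {g \<in> carrier G. g [^]\<^bsub>G\<^esub> (n::nat) = \<one>\<^bsub>G\<^esub>}"
proof -
  have "\<exists>F. finite F \<and> F \<subseteq> V \<and> (\<forall>h\<in>carrier G. (\<forall>v\<in>F. h v = g v) \<longrightarrow> h [^]\<^bsub>G\<^esub> n \<noteq> \<one>\<^bsub>G\<^esub>)"
    if g: "g \<in> carrier G" "g [^]\<^bsub>G\<^esub> n \<noteq> \<one>\<^bsub>G\<^esub>" for g
  proof -
    obtain v where v: "v \<in> V" "(g ^^ n) v \<noteq> v"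
      using aut_eqI[of "g [^]\<^bsub>G\<^esub> n" "\<one>\<^bsub>G\<^esub>"] g aut_pow[OF g(1)] aut_one by force
    have V: "(g ^^ i) v \<in> V" for i using v(1) aut_in_V[OF g(1)] by (induction i) auto
    have "h [^]\<^bsub>G\<^esub> n \<noteq> \<one>\<^bsub>G\<^esub>"
      if h: "h \<in> carrier G" "\<forall>u\<in>(\<lambda>i. (g ^^ i) v) ` {..<n}. h u = g u" for h
    proof
      assume "h [^]\<^bsub>G\<^esub> n = \<one>\<^bsub>G\<^esub>"
      then have "(h ^^ n) v = v" using aut_pow[OF h(1) v(1), of n] aut_one[OF v(1)] by simp
      moreover have "i \<le> n \<Longrightarrow> (h ^^ i) v = (g ^^ i) v" for i
        using h(2) by (induction i) auto
      ultimately show False using v(2) by simp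
    qed
    then show ?thesis using V by (intro exI[of _ "(\<lambda>i. (g ^^ i) v) ` {..<n}"]) auto
  qed
  then show ?thesis unfolding closedin_def topspace_X openin_X by auto
qed

lemma closedin_fixing:
  assumes "F \<subseteq> V" shows "closedin X (fixing F)"
proof -
  have "\<exists>F'. finite F' \<and> F' \<subseteq> V \<and> (\<forall>h\<in>carrier G. (\<forall>v\<in>F'. h v = g v) \<longrightarrow> h \<notin> fixing F)"
    if g: "g \<in> carrier G" "g \<notin> fixing F" for g
  proof -
    obtain v where v: "v \<in> F" "g v \<noteq> v" using g by (auto simp: fixing_def)
    then show ?thesis using assms by (intro exI[of _ "{v}"]) (force simp: fixing_def)
  qed
  then show ?thesis unfolding closedin_def topspace_X openin_X by (auto simp: fixing_def)
qed

text \<open>Compactness turns the finite sets that separate the single points of \<open>K\<close>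
  from \<open>H\<close> into one finite set, whose fixator serves as \<open>U\<close>.\<close>

lemma separate_compact:
  assumes K: "compactin X K" and H: "closedin X H" and disj: "K \<inter> H = {}"
  obtains U where "openin X U" "\<one>\<^bsub>G\<^esub> \<in> U" "K \<inter> (H <#>\<^bsub>G\<^esub> U) = {}"
proof -
  have KG: "K \<subseteq> carrier G" and HG: "H \<subseteq> carrier G"
    using compactin_subset_topspace[OF K] closedin_subset[OF H] by (simp_all add: topspace_X)
  have "\<exists>F. finite F \<and> F \<subseteq> V \<and> (\<forall>g\<in>carrier G. (\<forall>v\<in>F. g v = k v) \<longrightarrow> g \<notin> H)" if "k \<in> K" for k
  proof -
    have "openin X (carrier G - H)" using H by (simp add: closedin_def topspace_X)
    moreover have "k \<in> carrier G - H" using that KG disj by blast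
    ultimately have "\<exists>F. finite F \<and> F \<subseteq> V \<and>
        (\<forall>g\<in>carrier G. (\<forall>v\<in>F. g v = k v) \<longrightarrow> g \<in> carrier G - H)"
      unfolding openin_X by (elim conjE) (erule bspec)
    then show ?thesis by blast
  qed
  then obtain F where F: "\<And>k. k \<in> K \<Longrightarrow> finite (F k)" "\<And>k. k \<in> K \<Longrightarrow> F k \<subseteq> V"
    "\<And>k g. k \<in> K \<Longrightarrow> g \<in> carrier G \<Longrightarrow> (\<forall>v\<in>F k. g v = k v) \<Longrightarrow> g \<notin> H" by metis
  let ?O = "\<lambda>k. {g \<in> carrier G. \<forall>v\<in>F k. g v = k v}"
  have "openin X (?O k)" if "k \<in> K" for k
    unfolding openin_X
  proof (intro conjI ballI)
    fix g assume "g \<in> ?O k"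
    then show "\<exists>F'. finite F' \<and> F' \<subseteq> V \<and> (\<forall>g'\<in>carrier G. (\<forall>v\<in>F'. g' v = g v) \<longrightarrow> g' \<in> ?O k)"
      using F(1,2)[OF that] by (intro exI[of _ "F k"]) auto
  qed auto
  moreover have "K \<subseteq> \<Union> (?O ` K)" using KG by auto
  ultimately have "\<exists>\<F>. finite \<F> \<and> \<F> \<subseteq> ?O ` K \<and> K \<subseteq> \<Union>\<F>"
    using K by (simp add: compactin_def)
  then obtain \<F> where \<F>: "finite \<F>" "\<F> \<subseteq> ?O ` K" "K \<subseteq> \<Union>\<F>" by blast
  then obtain Q where Q: "finite Q" "Q \<subseteq> K" "\<F> = ?O ` Q"
    by (metis (no_types, lifting) finite_subset_image)
  let ?F = "\<Union> (F ` Q)"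
  have FV: "finite ?F" "?F \<subseteq> V" using Q F(1,2) by auto
  have "g \<notin> H <#>\<^bsub>G\<^esub> fixing ?F" if g: "g \<in> K" for g
  proof
    assume "g \<in> H <#>\<^bsub>G\<^esub> fixing ?F"
    then obtain h u where hu: "h \<in> H" "u \<in> fixing ?F" "g = h \<otimes>\<^bsub>G\<^esub> u" by (auto simp: set_mult_def)
    obtain k where k: "k \<in> Q" "\<forall>v\<in>F k. g v = k v" using \<F>(3) Q(3) g by blast
    \<comment> \<open>The factor \<open>u\<close> acts first and fixes \<open>F k\<close> pointwise,
      so \<open>h\<close> inherits the values of \<open>g\<close>, and hence of \<open>k\<close>, on
      \<open>F k\<close>.\<close>
    have "h v = k v" if v: "v \<in> F k" for v
    proof -
      have "v \<in> V" "u v = v" "u \<in> carrier G" "h \<in> carrier G"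
        using v k hu FV HG by (auto simp: fixing_def)
      then show ?thesis using k(2) v hu(3) by (metis aut_mult)
    qed
    then show False using F(3)[of k h] k Q hu HG by blast
  qed
  then show thesis
    using that[of "fixing ?F"] openin_fixing[OF FV] subgroup.one_closed[OF fixing_subgroup[OF FV(2)]]
    by blast
qed

section \<open>Orbits and torsion\<close>

text \<open>A shortest path from \<open>x\<close> to the orbit of \<open>v\<close> has its vertices in pairwise distinct orbits.\<close>

lemma near_orbit_representative:
  assumes J: "subgroup J G" and x: "x \<in> V" and v: "v \<in> V"
    and fin: "finite (orbits (G\<lparr>carrier := J\<rparr>) V (\<lambda>g. g))"
    and card: "card (orbits (G\<lparr>carrier := J\<rparr>) V (\<lambda>g. g)) \<le> c"
  obtains j where "j \<in> J" "j v \<in> vball x c"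
proof -
  let ?O = "\<lambda>w. {j w |j. j \<in> J}"
  have JG: "J \<subseteq> carrier G" using J by (rule subgroup.subset)
  have oneJ: "\<one>\<^bsub>G\<^esub> \<in> J" using J by (rule subgroup.one_closed)
  have orbs: "orbits (G\<lparr>carrier := J\<rparr>) V (\<lambda>g. g) = ?O ` V"
    by (auto simp: orbits_def orbit_def)
  \<comment> \<open>The distance from \<open>x\<close> to the orbit of \<open>v\<close>.\<close>
  define r where "r = (LEAST r. \<exists>j\<in>J. j v \<in> vball x r)"
  have ex: "\<exists>r. \<exists>j\<in>J. j v \<in> vball x r"
    using vball_exhausts[OF x v] oneJ aut_one[OF v] by metis
  obtain j where j: "j \<in> J" "j v \<in> vball x r"
    using LeastI_ex[OF ex] unfolding r_def by blast
  have least: "r \<le> s" if "i \<in> J" "i v \<in> vball x s" for i s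
    unfolding r_def using that by (blast intro: Least_le)
  from j(2) obtain f where f: "f 0 = x" "f r = j v" "\<And>i. i < r \<Longrightarrow> (f i, f (Suc i)) \<in> E\<^sup>="
    by (auto simp: vball_def relpow_fun_conv)
  have path: "i + k \<le> r \<Longrightarrow> f (i + k) \<in> vball (f i) k" for i k
  proof (induction k)
    case (Suc k)
    then show ?case using f(3)[of "i + k"] by (fastforce simp: vball_Suc)
  qed simp
  have fV: "f i \<in> V" if "i \<le> r" for i
    using path[of 0 i] that f(1) vball_subset[OF x] by auto
  \<comment> \<open>If \<open>q\<close> took \<open>f k\<close> back to \<open>f i\<close>, then
    following the path up to \<open>f i\<close> and continuing with the \<open>q\<close>-image of
    its tail would reach the orbit of \<open>v\<close> in \<open>i + (r - k)\<close> steps, fewer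
    than the minimum \<open>r\<close>.\<close>
  have neq: "?O (f i) \<noteq> ?O (f k)" if ik: "i < k" "k \<le> r" for i k
  proof
    assume "?O (f i) = ?O (f k)"
    moreover have "f i \<in> ?O (f i)" using oneJ aut_one[OF fV, of i] ik by simp metis
    ultimately obtain q where q: "q \<in> J" "q (f k) = f i" by auto
    have "q (j v) \<in> vball (f i) (r - k)"
      using aut_vball[of q "f k" "j v" "r - k"] path[of k "r - k"] q JG ik fV f(2) by auto
    then have "q (j v) \<in> vball x (i + (r - k))"
      using path[of 0 i] ik f(1) by (intro vball_trans[of "f i"]) auto
    moreover have "q (j v) = (q \<otimes>\<^bsub>G\<^esub> j) v" using aut_mult[of q j v] q(1) j(1) JG v by (simp add: subset_iff)
    moreover have "q \<otimes>\<^bsub>G\<^esub> j \<in> J" using subgroup.m_closed[OF J q(1) j(1)] .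
    ultimately have "r \<le> i + (r - k)" using least by metis
    then show False using ik by linarith
  qed
  have "inj_on (\<lambda>i. ?O (f i)) {..r}"
  proof (rule linorder_inj_onI')
    fix i k assume "k \<in> {..r}" "i < k"
    then show "?O (f i) \<noteq> ?O (f k)" by (intro neq) simp_all
  qed
  from card_image[OF this] have "card ((\<lambda>i. ?O (f i)) ` {..r}) = Suc r"
    by (simp only: card_atMost)
  moreover have "(\<lambda>i. ?O (f i)) ` {..r} \<subseteq> ?O ` V" using fV by (intro image_subsetI imageI) simp
  then have "card ((\<lambda>i. ?O (f i)) ` {..r}) \<le> card (?O ` V)" by (rule card_mono[OF fin[unfolded orbs]])
  \<comment> \<open>A path of length \<open>r\<close> has \<open>r + 1\<close> vertices, so the
    distance is even strictly below the bound on the number of orbits.\<close>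
  ultimately have "Suc r \<le> c" using card unfolding orbs by (simp only: order_trans)
  then have "vball x r \<subseteq> vball x c" by (intro vball_mono) simp
  then show thesis using that[OF j(1)] j(2) by blast
qed

text \<open>The iterates of \<open>v\<close> under \<open>g\<close> stay in \<open>W\<close>, and
  the first \<open>p\<close> of them are distinct because a nontrivial orbit of a cyclic group of
  prime order has full length.\<close>

lemma prime_order_le_card:
  assumes g: "g \<in> carrier G" "g [^]\<^bsub>G\<^esub> p = \<one>\<^bsub>G\<^esub>" and p: "prime (p::nat)"
    and W: "finite W" "W \<subseteq> V" "g ` W \<subseteq> W" and v: "v \<in> W" "g v \<noteq> v"
  shows "p \<le> card W"
proof (rule ccontr)
  assume less: "\<not> p \<le> card W"
  have gW: "(g ^^ i) v \<in> W" for i using v(1) W(3) by (induction i) auto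
  have "inj_on (\<lambda>i. (g ^^ i) v) {..<p}"
  proof (rule linorder_inj_onI')
    fix i k assume ik: "i \<in> {..<p}" "k \<in> {..<p}" "i < k"
    show "(g ^^ i) v \<noteq> (g ^^ k) v"
    proof
      assume eq: "(g ^^ i) v = (g ^^ k) v"
      let ?h = "g [^]\<^bsub>G\<^esub> i" and ?d = "k - i"
      have "(g ^^ k) v = (g ^^ i) ((g ^^ ?d) v)"
        using ik by (metis comp_apply funpow_add le_add_diff_inverse less_imp_le_nat)
      then have "?h v = ?h ((g ^^ ?d) v)"
        using eq g v W gW[of ?d] by (simp add: aut_pow subset_iff)
      then have d: "(g ^^ ?d) v = v" using aut_inj[of ?h "(g ^^ ?d) v" v] g(1) v(1) W(2) gW[of ?d] by auto
      have pv: "(g ^^ p) v = v" using aut_pow[OF g(1), of v p] g(2) v W aut_one by auto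
      have "\<not> p dvd ?d" using ik by (auto dest!: dvd_imp_le)
      then have "coprime ?d p" using prime_imp_coprime[OF p] coprime_commute by blast
      \<comment> \<open>Both the iterate of order \<open>k - i\<close> and the one of order
        \<open>p\<close> fix \<open>v\<close>. Since the exponents are coprime, Bezout forces
        \<open>g\<close> itself to fix \<open>v\<close>.\<close>
      then obtain a b where ab: "?d * a = p * b + 1"
        using coprime_bezout_strong[of ?d p] p prime_gt_1_nat[OF p] by auto
      have mult: "(g ^^ (m * a)) v = v" if "(g ^^ m) v = v" for m a
        using that by (induction a) (auto simp: funpow_add)
      have "g ((g ^^ (p * b)) v) = v" using mult[OF d, of a] ab by simp
      then show False using mult[OF pv, of b] v(2) by simp
    qed
  qed
  then have "card ((\<lambda>i. (g ^^ i) v) ` {..<p}) = p" by (simp add: card_image)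
  moreover have "card ((\<lambda>i. (g ^^ i) v) ` {..<p}) \<le> card W" using gW W(1) by (intro card_mono) auto
  ultimately show False using less by simp
qed

end

text \<open>Take the least positive exponent \<open>m\<close> that kills some nontrivial element
  \<open>g\<close> of \<open>L\<close>, and a prime \<open>p\<close> dividing it. By minimality the
  power of \<open>g\<close> with exponent \<open>m / p\<close> is still nontrivial, and its
  \<open>p\<close>-th power is trivial.\<close>

lemma (in group) prime_order_element:
  assumes L: "subgroup L G" and nt: "\<not> torsion_free (G\<lparr>carrier := L\<rparr>)"
  obtains g p where "g \<in> L" "g \<noteq> \<one>" "prime (p::nat)" "g [^] p = \<one>"
proof -
  define P where "P m \<longleftrightarrow> 0 < m \<and> (\<exists>g\<in>L. g \<noteq> \<one> \<and> g [^] m = \<one>)" for m :: nat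
  have "\<exists>m. P m" using nt by (auto simp: P_def torsion_free_def nat_pow_consistent[symmetric])
  define m where "m = (LEAST m. P m)"
  have "P m" unfolding m_def by (rule LeastI_ex) fact
  then obtain g where g: "0 < m" "g \<in> L" "g \<noteq> \<one>" "g [^] m = \<one>" by (auto simp: P_def)
  have gG: "g \<in> carrier G" using g(2) subgroup.subset[OF L] by blast
  have "m \<noteq> 1" using g gG by auto
  then obtain p where p: "prime p" "p dvd m" using prime_factor_nat by blast
  then obtain q where q: "m = q * p" by (metis dvd_div_mult_self)
  have "q < m" "0 < q" using q g(1) prime_gt_1_nat[OF p(1)] by auto
  then have "\<not> P q" unfolding m_def by (blast dest: not_less_Least)
  then have "g [^] q \<noteq> \<one>" using g \<open>0 < q\<close> by (auto simp: P_def)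
  moreover have "g [^] q \<in> L" using g(2) L
    by (induction q) (auto simp: subgroup.one_closed subgroup.m_closed)
  moreover have "(g [^] q) [^] p = \<one>" using g(4) gG q by (simp add: nat_pow_pow)
  ultimately show thesis using that p(1) by blast
qed


section \<open>Chabauty-open conditions and radii witnessing local torsion-freeness\<close>

context locally_finite_connected_graph
begin

text \<open>With \<open>U\<close> chosen so that \<open>H U\<close> misses \<open>K\<close>, the
  inclusion of \<open>J \<inter> K\<close> in \<open>H U\<close> forces \<open>J\<close> to miss
  \<open>K\<close> as well.\<close>

lemma avoiding_compact_open:
  assumes K: "compactin X K"
  shows "openin (chabauty G X) {J \<in> closed_subgroups G X. J \<inter> K = {}}"
  unfolding openin_chabauty chabauty_open_def
proof (intro conjI ballI)
  fix H assume "H \<in> {J \<in> closed_subgroups G X. J \<inter> K = {}}"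
  then have "closedin X H" "K \<inter> H = {}" by (auto simp: closed_subgroups_def)
  then obtain U where U: "openin X U" "\<one>\<^bsub>G\<^esub> \<in> U" "K \<inter> (H <#>\<^bsub>G\<^esub> U) = {}"
    using separate_compact[OF K] by blast
  then have "chabauty_nhd G X H K U \<subseteq> {J \<in> closed_subgroups G X. J \<inter> K = {}}"
    by (auto simp: chabauty_nhd_def)
  then show "\<exists>K' U. compactin X K' \<and> openin X U \<and> \<one>\<^bsub>G\<^esub> \<in> U \<and>
      chabauty_nhd G X H K' U \<subseteq> {J \<in> closed_subgroups G X. J \<inter> K = {}}"
    using K U by blast
qed auto

lemma torsion_free_subset:
  "torsion_free (G\<lparr>carrier := A\<rparr>) \<Longrightarrow> B \<subseteq> A \<Longrightarrow> torsion_free (G\<lparr>carrier := B\<rparr>)"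
  by (auto simp: torsion_free_def Aut.nat_pow_consistent[symmetric])

lemma torsion_freeD:
  "torsion_free (G\<lparr>carrier := A\<rparr>) \<Longrightarrow> g \<in> A \<Longrightarrow> 0 < (n::nat) \<Longrightarrow> g [^]\<^bsub>G\<^esub> n = \<one>\<^bsub>G\<^esub> \<Longrightarrow> g = \<one>\<^bsub>G\<^esub>"
  by (auto simp: torsion_free_def Aut.nat_pow_consistent[symmetric])

text \<open>The fixators of balls around \<open>x\<close> are open subgroups and form a neighborhood
  base of the identity, so an open torsion-free subgroup can be replaced by a radius.\<close>

lemma locally_torsion_free_iff_vball:
  assumes H: "subgroup H G" and x: "x \<in> V"
  shows "locally_torsion_free (G\<lparr>carrier := H\<rparr>) (subtopology X H) \<longleftrightarrow>
    (\<exists>n. torsion_free (G\<lparr>carrier := H \<inter> fixing (vball x n)\<rparr>))"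
proof
  assume "locally_torsion_free (G\<lparr>carrier := H\<rparr>) (subtopology X H)"
  then obtain L where L: "subgroup L (G\<lparr>carrier := H\<rparr>)" "openin (subtopology X H) L"
    "torsion_free (G\<lparr>carrier := L\<rparr>)" by (auto simp: locally_torsion_free_def)
  then obtain W where W: "openin X W" "L = W \<inter> H" by (auto simp: openin_subtopology)
  have "\<one>\<^bsub>G\<^esub> \<in> W" using subgroup.one_closed[OF L(1)] W(2) by simp
  then obtain F where F: "finite F" "F \<subseteq> V" "fixing F \<subseteq> W" using openin_X_one[OF W(1)] by blast
  obtain n where "F \<subseteq> vball x n" using finite_subset_vball[OF x F(1,2)] .
  then have "H \<inter> fixing (vball x n) \<subseteq> L" using F(3) W(2) fixing_mono by blast
  then show "\<exists>n. torsion_free (G\<lparr>carrier := H \<inter> fixing (vball x n)\<rparr>)"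
    using torsion_free_subset[OF L(3)] by blast
next
  assume "\<exists>n. torsion_free (G\<lparr>carrier := H \<inter> fixing (vball x n)\<rparr>)"
  then obtain n where n: "torsion_free (G\<lparr>carrier := H \<inter> fixing (vball x n)\<rparr>)" ..
  have fix_x: "subgroup (fixing (vball x n)) G" by (rule fixing_subgroup[OF vball_subset[OF x]])
  have "subgroup (H \<inter> fixing (vball x n)) (G\<lparr>carrier := H\<rparr>)"
    using Aut.subgroup_incl[OF Aut.subgroups_Inter_pair[OF H fix_x] H] by simp
  moreover have "openin (subtopology X H) (H \<inter> fixing (vball x n))"
    using openin_fixing[OF finite_vball vball_subset, OF x x]
    by (auto simp: openin_subtopology Int_commute)
  ultimately show "locally_torsion_free (G\<lparr>carrier := H\<rparr>) (subtopology X H)"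
    using n by (auto simp: locally_torsion_free_def)
qed

section \<open>Torsion near a base vertex\<close>

text \<open>Otherwise fixing the \<open>n\<close>-ball around a vertex would imply fixing the larger
  ball, which contains the \<open>n\<close>-balls around all neighbors. By connectedness
  \<open>g\<close> would then fix every vertex.\<close>

lemma last_fixed_ball:
  assumes g: "g \<in> fixing (vball x n)" "g \<noteq> \<one>\<^bsub>G\<^esub>" and x: "x \<in> V"
  obtains y where "y \<in> V" "g \<in> fixing (vball y n)" "g \<notin> fixing (vball y (Suc n))"
proof (rule ccontr)
  assume "\<not> thesis"
  then have grow: "g \<in> fixing (vball y (Suc n))" if "y \<in> V" "g \<in> fixing (vball y n)" for y
    using \<open>\<And>y. y \<in> V \<Longrightarrow> g \<in> fixing (vball y n) \<Longrightarrow> g \<notin> fixing (vball y (Suc n)) \<Longrightarrow> thesis\<close>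
      that by blast
  have "v \<in> V \<and> g \<in> fixing (vball v n)" if "(x, v) \<in> E\<^sup>*" for v
    using that
  proof induction
    case (step v w)
    then have "w \<in> vball v 1" by (auto simp: vball_Suc)
    then have "vball w n \<subseteq> vball v (Suc n)" using vball_trans[of w v 1 _ n] by auto
    then have "g \<in> fixing (vball w n)"
      using step.IH grow fixing_mono by blast
    then show ?case using step edges by auto
  qed (use g x in auto)
  then have fixed: "g v = v" if "v \<in> V" for v
    using connected[OF x that] vball_self[of v n] by (auto simp: fixing_def)
  have "g = \<one>\<^bsub>G\<^esub>" by (rule aut_eqI) (use g fixed aut_one in \<open>auto simp: fixing_def\<close>)
  then show False using g(2) by simp
qed

text \<open>The fixed exponent makes this set closed. The factorial is a multiple of every prime order that
  can occur.\<close>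

definition torsion_witnesses :: "'v \<Rightarrow> nat \<Rightarrow> nat \<Rightarrow> ('v \<Rightarrow> 'v) set" where
  "torsion_witnesses x c n = (\<Union>y\<in>vball x c.
     {g \<in> fixing (vball y n) - fixing (vball y (Suc n)).
        g [^]\<^bsub>G\<^esub> (fact (card (vball x (c + Suc n))) :: nat) = \<one>\<^bsub>G\<^esub>})"

text \<open>A finite union of closed subsets of compact vertex stabilizers. Removing a fixator keeps
  a piece closed because the fixator of a finite ball is open.\<close>

lemma compactin_torsion_witnesses:
  assumes x: "x \<in> V" shows "compactin X (torsion_witnesses x c n)"
  unfolding torsion_witnesses_def
proof (rule compactin_Union, safe)
  fix y assume "y \<in> vball x c"
  then have y: "y \<in> V" using vball_subset[OF x] by blast
  let ?N = "fact (card (vball x (c + Suc n))) :: nat"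
  let ?A = "{g \<in> fixing (vball y n) - fixing (vball y (Suc n)). g [^]\<^bsub>G\<^esub> ?N = \<one>\<^bsub>G\<^esub>}"
  have "?A = (fixing (vball y n) - fixing (vball y (Suc n))) \<inter> {g \<in> carrier G. g [^]\<^bsub>G\<^esub> ?N = \<one>\<^bsub>G\<^esub>}"
    by (auto simp: fixing_def)
  moreover have "closedin X (fixing (vball y n) - fixing (vball y (Suc n)))"
    by (intro closedin_diff closedin_fixing openin_fixing vball_subset finite_vball y)
  ultimately have "closedin X ?A" using closedin_exponent by (simp add: closedin_Int)
  moreover have "?A \<subseteq> fixing {y}" using fixing_mono[of "{y}" "vball y n"] by auto
  ultimately show "compactin X ?A" using closed_compactin compactin_stabilizer[OF y] by blast
qed (use finite_vball x in auto)

text \<open>The radius \<open>c + m\<close> makes the fixed ball around any \<open>y\<close> in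
  \<open>vball x c\<close> contain \<open>vball x m\<close>. A witness in \<open>H\<close> would
  thus be trivial, yet the identity fixes the next larger ball too.\<close>

lemma torsion_witnesses_disjoint:
  assumes H: "torsion_free (G\<lparr>carrier := H \<inter> fixing (vball x m)\<rparr>)" and x: "x \<in> V"
  shows "H \<inter> torsion_witnesses x c (c + m) = {}"
proof (rule ccontr)
  assume "H \<inter> torsion_witnesses x c (c + m) \<noteq> {}"
  then obtain g y where g: "g \<in> H" and y: "y \<in> vball x c"
    and fix_y: "g \<in> fixing (vball y (c + m))" "g \<notin> fixing (vball y (Suc (c + m)))"
    and tors: "g [^]\<^bsub>G\<^esub> (fact (card (vball x (c + Suc (c + m)))) :: nat) = \<one>\<^bsub>G\<^esub>"
    by (auto simp: torsion_witnesses_def)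
  have "vball x m \<subseteq> vball y (c + m)" using vball_trans[OF vball_sym[OF y]] by blast
  then have "g \<in> H \<inter> fixing (vball x m)" using g fix_y(1) fixing_mono by blast
  then have "g = \<one>\<^bsub>G\<^esub>"
    using torsion_freeD[OF H _ fact_gt_zero tors] by blast
  moreover have "vball y (Suc (c + m)) \<subseteq> V" using vball_subset x y by blast
  ultimately show False using fix_y(2) fixing_subgroup subgroup.one_closed by blast
qed

lemma torsion_free_if_no_witness:
  assumes J: "subgroup J G" and disj: "J \<inter> torsion_witnesses x c n = {}" and x: "x \<in> V"
    and near: "\<And>v. v \<in> V \<Longrightarrow> \<exists>j\<in>J. j v \<in> vball x c"
  shows "torsion_free (G\<lparr>carrier := J \<inter> fixing (vball x n)\<rparr>)"
proof (rule ccontr)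
  assume "\<not> ?thesis"
  moreover have "subgroup (J \<inter> fixing (vball x n)) G"
    using J fixing_subgroup[OF vball_subset[OF x]] by (rule Aut.subgroups_Inter_pair)
  ultimately obtain g p where g: "g \<in> J \<inter> fixing (vball x n)" "g \<noteq> \<one>\<^bsub>G\<^esub>"
    and p: "prime (p::nat)" "g [^]\<^bsub>G\<^esub> p = \<one>\<^bsub>G\<^esub>"
    using Aut.prime_order_element by blast
  obtain y where y: "y \<in> V" "g \<in> fixing (vball y n)" "g \<notin> fixing (vball y (Suc n))"
    using last_fixed_ball[OF _ g(2) x] g(1) by blast
  obtain j where j: "j \<in> J" "j y \<in> vball x c" using near[OF y(1)] by blast
  have gG: "g \<in> carrier G" and jG: "j \<in> carrier G"
    using g(1) j(1) subgroup.subset[OF J] by auto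
  \<comment> \<open>Conjugating by \<open>j\<close> keeps the element in \<open>J\<close> and moves
    the last fixed ball to the center \<open>j y\<close>, close to \<open>x\<close>.\<close>
  define h where "h = j \<otimes>\<^bsub>G\<^esub> g \<otimes>\<^bsub>G\<^esub> inv\<^bsub>G\<^esub> j"
  have hJ: "h \<in> J" using g(1) j(1) J by (simp add: h_def subgroup.m_closed subgroup.m_inv_closed)
  have h: "h \<in> fixing (vball (j y) n)" "h \<notin> fixing (vball (j y) (Suc n))"
    using y fixing_conj[OF gG jG y(1)] by (simp_all add: h_def)
  then have hG: "h \<in> carrier G" by (simp add: fixing_def)
  have hpow: "h [^]\<^bsub>G\<^esub> k = j \<otimes>\<^bsub>G\<^esub> g [^]\<^bsub>G\<^esub> k \<otimes>\<^bsub>G\<^esub> inv\<^bsub>G\<^esub> j" for k :: nat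
  proof (induction k)
    case (Suc k)
    have "inv\<^bsub>G\<^esub> j \<otimes>\<^bsub>G\<^esub> (j \<otimes>\<^bsub>G\<^esub> (g \<otimes>\<^bsub>G\<^esub> inv\<^bsub>G\<^esub> j)) = g \<otimes>\<^bsub>G\<^esub> inv\<^bsub>G\<^esub> j"
      using gG jG by (simp add: Aut.m_assoc[symmetric])
    then show ?case using Suc gG jG by (simp add: h_def Aut.m_assoc)
  qed (use jG in simp)
  have hp: "h [^]\<^bsub>G\<^esub> p = \<one>\<^bsub>G\<^esub>" using hpow[of p] p(2) jG by simp
  let ?W = "vball (j y) (Suc n)"
  have jy: "j y \<in> V" using aut_in_V[OF jG y(1)] .
  have "h (j y) = j y" using h(1) by (simp add: fixing_def)
  then have "h ` ?W \<subseteq> ?W" using aut_vball[OF hG jy, of _ "Suc n"] by auto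
  moreover obtain v where "v \<in> ?W" "h v \<noteq> v" using h(2) hG by (auto simp: fixing_def)
  ultimately have "p \<le> card ?W"
    using prime_order_le_card[OF hG hp p(1) finite_vball[OF jy] vball_subset[OF jy]] by blast
  \<comment> \<open>As \<open>j y\<close> is within \<open>c\<close> of \<open>x\<close>, the bound
    on \<open>p\<close> becomes independent of \<open>g\<close>, \<open>y\<close> and
    \<open>J\<close>. This is why one factorial exponent covers all primes that arise.\<close>
  also have "\<dots> \<le> card (vball x (c + Suc n))"
    using vball_trans[OF j(2)] by (intro card_mono finite_vball x) blast
  finally have "p dvd fact (card (vball x (c + Suc n)))"
    using p(1) by (simp add: prime_dvd_fact_iff)
  then obtain q where "fact (card (vball x (c + Suc n))) = p * q" ..
  then have "h [^]\<^bsub>G\<^esub> (fact (card (vball x (c + Suc n))) :: nat) = \<one>\<^bsub>G\<^esub>"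
    using hp hG by (simp add: Aut.nat_pow_pow[symmetric])
  then have "h \<in> torsion_witnesses x c n" using h j(2) by (auto simp: torsion_witnesses_def)
  then show False using disj hJ by blast
qed

end

section \<open>Openness of the set of locally torsion-free groups\<close>

theorem proposition5p22:
  fixes V :: "'v set" and E :: "'v rel" and C :: real
  assumes "is_tree V E"
    and "locally_finite_graph V E"
    and "\<forall>v\<in>V. 2 \<le> vertex_degree E v"
    and "0 < C"
  shows "openin (subtopology (chabauty (Aut V E) (Aut_topology V E)) (Sub_le0 V E C))
           {H \<in> Sub_le0 V E C.
              locally_torsion_free ((Aut V E)\<lparr>carrier := H\<rparr>) (subtopology (Aut_topology V E) H)}"
proof -
  interpret locally_finite_connected_graph V E
    using assms(1,2) by unfold_locales (auto simp: is_tree_def)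
  obtain x where x: "x \<in> V" using assms(1) by (auto simp: is_tree_def)
  \<comment> \<open>Orbit counts are natural numbers, so the real bound \<open>C\<close> may be
    rounded down.\<close>
  define c where "c = nat \<lfloor>C\<rfloor>"
  have near: "\<exists>j\<in>J. j v \<in> vball x c" if "J \<in> Sub_le0 V E C" "v \<in> V" for J v
  proof -
    have J: "subgroup J G" "finite (orbits (G\<lparr>carrier := J\<rparr>) V (\<lambda>g. g))"
      "real (card (orbits (G\<lparr>carrier := J\<rparr>) V (\<lambda>g. g))) \<le> C"
      using that(1) by (simp_all add: Sub_le0_def closed_subgroups_def)
    have "card (orbits (G\<lparr>carrier := J\<rparr>) V (\<lambda>g. g)) \<le> c"
      unfolding c_def using J(3) by (simp add: le_nat_floor)
    then show ?thesis using near_orbit_representative[OF J(1) x that(2) J(2)] by blast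
  qed
  let ?LTF = "{H \<in> Sub_le0 V E C. locally_torsion_free (G\<lparr>carrier := H\<rparr>) (subtopology X H)}"
  have "\<exists>T. openin (subtopology (chabauty G X) (Sub_le0 V E C)) T \<and> H \<in> T \<and> T \<subseteq> ?LTF"
    if HL: "H \<in> ?LTF" for H
  proof -
    have H: "H \<in> Sub_le0 V E C" "H \<in> closed_subgroups G X" "subgroup H G"
      using HL by (auto simp: Sub_le0_def closed_subgroups_def)
    obtain m where m: "torsion_free (G\<lparr>carrier := H \<inter> fixing (vball x m)\<rparr>)"
      using HL locally_torsion_free_iff_vball[OF H(3) x] by blast
    \<comment> \<open>This compact set depends on \<open>H\<close> only through the radius
      \<open>m\<close>. Avoiding it yields torsion-freeness on the fixator of the ball of the larger
      radius \<open>c + m\<close>, for every group in the subspace.\<close>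
    let ?K = "torsion_witnesses x c (c + m)"
    let ?T = "{J \<in> closed_subgroups G X. J \<inter> ?K = {}} \<inter> Sub_le0 V E C"
    have "J \<in> ?LTF" if "J \<in> ?T" for J
    proof -
      have J: "J \<in> Sub_le0 V E C" "subgroup J G" "J \<inter> ?K = {}"
        using that by (auto simp: closed_subgroups_def)
      have "torsion_free (G\<lparr>carrier := J \<inter> fixing (vball x (c + m))\<rparr>)"
        using torsion_free_if_no_witness[OF J(2,3) x] near[OF J(1)] by blast
      then show ?thesis using locally_torsion_free_iff_vball[OF J(2) x] J(1) by blast
    qed
    moreover have "openin (subtopology (chabauty G X) (Sub_le0 V E C)) ?T"
      using avoiding_compact_open[OF compactin_torsion_witnesses[OF x]]
      by (rule openin_subtopology_Int)
    moreover have "H \<in> ?T" using H torsion_witnesses_disjoint[OF m x] by simp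
    ultimately show ?thesis by blast
  qed
  then show ?thesis by (subst openin_subopen) blast
qed

end
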